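(* Let $AB$ be a fixed line segment and $Y$ a given rectangle. For each area, consider the rectangle $AB^+C^+D$ of that area applied to $AB$ and exceeding by a rectangle $BB^+C^+C$ similar to $Y$; let $AIHG$ be the square of equal area, similarly situated to $AB^+C^+D$ with a corner at $A$, and let $J^+$ be the point at which the boundaries of $AIHG$ and $AB^+C^+D$ intersect, as specified in the context. For all possible areas applied to the fixed line segment $AB$ in the form of a rectangle $AB^+C^+D$, the point $J^+$ traces out a hyperbolic curve.
   Context: A rectangle $AB^+C^+D$ is applied to a segment $AB$ exceeding by a rectangle similar to a given rectangle $Y$ if its base $AB^+$ extends $AB$ beyond $B$ and the rectangle $BB^+C^+C$ of the same height $AD=B^+C^+$ erected on the excess $BB^+$ is similar to $Y$. With $\lambda$ the fixed ratio of the sides of $Y$, this means $BB^+=\lambda\cdot AD$. The companion square $AIHG$ has the same area as $AB^+C^+D$, with $I$ on the ray $AB$ and $G$ on the ray $AD$. The point $J^+$ is the intersection of the side $IH$ of the square with the top side $DC^+$ of the rectangle, these sides being extended if $AB^+<B^+C^+$. Thus the distance of $J^+$ from the line $AD$ is $AI$ and its distance from the line $AB$ is $AD$. The segment $AB$ and the rectangle $Y$ are fixed while the applied area, equivalently the height $AD$, varies. "Hyperbolic curve" refers to the conic called the hyperbola. *)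

theory Defs
  imports "HOL-Analysis.Analysis"
begin

type_synonym point = "real ^ 2"

definition rectangle :: "point \<Rightarrow> point \<Rightarrow> point \<Rightarrow> point \<Rightarrow> bool" where
  "rectangle P Q R S \<longleftrightarrow>
     Q \<noteq> P \<and> S \<noteq> P \<and> (Q - P) \<bullet> (S - P) = 0 \<and> R - Q = S - P"

definition square :: "point \<Rightarrow> point \<Rightarrow> point \<Rightarrow> point \<Rightarrow> bool" where
  "square P Q R S \<longleftrightarrow> rectangle P Q R S \<and> dist P Q = dist P S"

definition area :: "point \<Rightarrow> point \<Rightarrow> point \<Rightarrow> point \<Rightarrow> real" where
  "area P Q R S = measure lebesgue (convex hull {P, Q, R, S})"

text \<open>Similarity of polygons given by their vertices, under the vertex correspondence
  prescribed by the order of the two lists.\<close>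

definition similar :: "point list \<Rightarrow> point list \<Rightarrow> bool" where
  "similar ps qs \<longleftrightarrow> length ps = length qs \<and>
     (\<exists>k>0. \<forall>i<length ps. \<forall>j<length ps. dist (ps ! i) (ps ! j) = k * dist (qs ! i) (qs ! j))"

definition ray :: "point \<Rightarrow> point \<Rightarrow> point set" where
  "ray P Q = {P + t *\<^sub>R (Q - P) | t. 0 \<le> t}"

text \<open>The rectangle \<open>A B' C' D\<close> is applied to the segment \<open>A B\<close> and exceeds by the rectangle
  \<open>B B' C' C\<close>, which is similar to \<open>Y1 Y2 Y3 Y4\<close>. The point \<open>E\<close> only selects the side of
  \<open>A B\<close> on which the rectangle is erected.\<close>

definition applied_exceeding ::
  "point \<Rightarrow> point \<Rightarrow> point \<Rightarrow> point \<Rightarrow> point \<Rightarrow> point \<Rightarrow> point \<Rightarrow> point \<Rightarrow> point \<Rightarrow> point \<Rightarrow> bool" where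
  "applied_exceeding Y1 Y2 Y3 Y4 A B E B' C' D \<longleftrightarrow>
     rectangle A B' C' D \<and> B \<in> open_segment A B' \<and> D \<in> ray A E \<and>
     (\<exists>C. rectangle B B' C' C \<and> similar [B, B', C', C] [Y1, Y2, Y3, Y4])"

definition companion_square ::
  "point \<Rightarrow> point \<Rightarrow> point \<Rightarrow> point \<Rightarrow> point \<Rightarrow> point \<Rightarrow> point \<Rightarrow> point \<Rightarrow> bool" where
  "companion_square A B B' C' D I H G \<longleftrightarrow>
     square A I H G \<and> I \<in> ray A B \<and> G \<in> ray A D \<and> area A I H G = area A B' C' D"

text \<open>\<open>J\<close> is the point \<open>J\<^sup>+\<close> belonging to the applied area \<open>\<alpha>\<close>: the intersection of the
  sides \<open>I H\<close> and \<open>D C'\<close>, which have to be extended to lines when the rectangle is higher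
  than it is wide.\<close>

definition J_plus ::
  "point \<Rightarrow> point \<Rightarrow> point \<Rightarrow> point \<Rightarrow> point \<Rightarrow> point \<Rightarrow> point \<Rightarrow> real \<Rightarrow> point \<Rightarrow> bool" where
  "J_plus Y1 Y2 Y3 Y4 A B E \<alpha> J \<longleftrightarrow>
     (\<exists>B' C' D I H G.
        applied_exceeding Y1 Y2 Y3 Y4 A B E B' C' D \<and> area A B' C' D = \<alpha> \<and>
        companion_square A B B' C' D I H G \<and>
        J \<in> (if dist A B' < dist B' C'
             then affine hull {I, H} \<inter> affine hull {D, C'}
             else closed_segment I H \<inter> closed_segment D C'))"

text \<open>A hyperbola (both branches), by the two-focus definition.\<close>

definition hyperbola :: "point set \<Rightarrow> bool" where
  "hyperbola K \<longleftrightarrow>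
     (\<exists>F1 F2 a. 0 < a \<and> 2 * a < dist F1 F2 \<and> K = {P. \<bar>dist P F1 - dist P F2\<bar> = 2 * a})"

end

theory Submission
  imports Defs
begin

text \<open>In orthonormal coordinates with origin \<open>A\<close> and axes along \<open>A B\<close> and \<open>A E\<close>, put
  \<open>c = A B\<close>, let \<open>l\<close> be the side ratio of \<open>Y\<close> and \<open>d\<close> the height of the applied rectangle. Its base
  is \<open>c + l * d\<close>, so its area \<open>\<alpha> = (c + l * d) * d\<close> determines \<open>d > 0\<close>, and \<open>J\<^sup>+\<close> is the point
  \<open>(sqrt \<alpha>, d)\<close>. Hence the locus is the open first quadrant part of \<open>x\<^sup>2 = (c + l * y) * y\<close>.\<close>

section \<open>Rectangles: distances, similarity and area\<close>

text \<open>Opposite sides are translates of each other, and both diagonals follow from Pythagoras.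
  Hence all six distances between vertices depend only on the two sides at \<open>P\<close>.\<close>

lemma rectangle_dist:
  assumes "rectangle P Q R S"
  shows "dist Q R = dist P S" "dist S R = dist P Q"
    "dist P R = sqrt ((dist P Q)\<^sup>2 + (dist P S)\<^sup>2)"
    "dist Q S = sqrt ((dist P Q)\<^sup>2 + (dist P S)\<^sup>2)"
proof -
  define p q where "p = Q - P" and "q = S - P"
  have pq: "Q = P + p" "S = P + q" "R = P + (p + q)" "p \<bullet> q = 0"
    using assms by (auto simp: rectangle_def p_def q_def algebra_simps)
  show "dist Q R = dist P S" "dist S R = dist P Q"
    unfolding pq by (simp_all add: dist_norm)
  have "(norm (p + q))\<^sup>2 = (norm p)\<^sup>2 + (norm q)\<^sup>2" "(norm (p - q))\<^sup>2 = (norm p)\<^sup>2 + (norm q)\<^sup>2"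
    using \<open>p \<bullet> q = 0\<close> by (simp_all add: power2_norm_eq_inner algebra_simps inner_commute)
  then have "norm (p + q) = sqrt ((norm p)\<^sup>2 + (norm q)\<^sup>2)"
    "norm (p - q) = sqrt ((norm p)\<^sup>2 + (norm q)\<^sup>2)"
    by (metis norm_ge_zero real_sqrt_unique)+
  then show "dist P R = sqrt ((dist P Q)\<^sup>2 + (dist P S)\<^sup>2)"
    "dist Q S = sqrt ((dist P Q)\<^sup>2 + (dist P S)\<^sup>2)"
    unfolding pq by (simp_all add: dist_norm norm_minus_commute add.commute)
qed

text \<open>Of all the distances that \<open>similar\<close> compares, only two adjacent sides carry
  information; \<open>rectangle_dist\<close> supplies the rest. The diagonals scale along because
  \<open>k > 0\<close> can be pulled out of the square root.\<close>

lemma similar_rectangles_iff: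
  assumes "rectangle P Q R S" "rectangle P' Q' R' S'"
  shows "similar [P, Q, R, S] [P', Q', R', S'] \<longleftrightarrow>
    (\<exists>k>0. dist P Q = k * dist P' Q' \<and> dist P S = k * dist P' S')"
proof
  assume "similar [P, Q, R, S] [P', Q', R', S']"
  then obtain k where "k > 0" and k: "\<And>i j. i < 4 \<Longrightarrow> j < 4 \<Longrightarrow>
      dist ([P, Q, R, S] ! i) ([P, Q, R, S] ! j) = k * dist ([P', Q', R', S'] ! i) ([P', Q', R', S'] ! j)"
    unfolding similar_def by auto
  then show "\<exists>k>0. dist P Q = k * dist P' Q' \<and> dist P S = k * dist P' S'"
    using k[of 0 1] k[of 0 3] by auto
next
  assume "\<exists>k>0. dist P Q = k * dist P' Q' \<and> dist P S = k * dist P' S'"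
  then obtain k where k: "k > 0" "dist P Q = k * dist P' Q'" "dist P S = k * dist P' S'"
    by blast
  have "sqrt ((k * dist P' Q')\<^sup>2 + (k * dist P' S')\<^sup>2) = k * sqrt ((dist P' Q')\<^sup>2 + (dist P' S')\<^sup>2)"
    using k(1) by (simp add: power_mult_distrib real_sqrt_mult flip: distrib_left)
  then have "dist ([P, Q, R, S] ! i) ([P, Q, R, S] ! j) = k * dist ([P', Q', R', S'] ! i) ([P', Q', R', S'] ! j)"
    if "i < 4" "j < 4" for i j
    using that rectangle_dist[OF assms(1)] rectangle_dist[OF assms(2)] k
    by (auto simp: less_Suc_eq numeral_eq_Suc dist_commute)
  with k(1) show "similar [P, Q, R, S] [P', Q', R', S']"
    unfolding similar_def by auto
qed

text \<open>The unit square in the form that \<open>area\<close> uses, as a hull of four listed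
  corners, so that any rectangle becomes an affine image of a box of known measure.\<close>

lemma unit_square_convex_hull:
  "cbox 0 1 = convex hull {0, vector [1, 0], vector [1, 1], vector [0, 1] :: real^2}"
proof -
  have one: "One = (1 :: real^2)"
    by (simp add: Cart_1)
  have "(\<forall>i\<in>Basis. x \<bullet> i = 0 \<or> x \<bullet> i = 1) \<longleftrightarrow> (\<forall>i. x $ i = 0 \<or> x $ i = 1)" for x :: "real^2"
    by (auto simp: Basis_vec_def inner_axis)
  moreover have "{x :: real^2. \<forall>i. x $ i = 0 \<or> x $ i = 1} =
      {0, vector [1, 0], vector [1, 1], vector [0, 1]}"
    by (auto simp: vec_eq_iff forall_2)
  ultimately show ?thesis
    using unit_interval_convex_hull[where 'a = "real^2"] unfolding one by simp
qed

text \<open>Up to translation the rectangle is the image of the unit square under the linear map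
  \<open>f\<close> sending the axis vectors to the sides \<open>p\<close> and \<open>q\<close>. Its
  measure is therefore the absolute determinant of \<open>f\<close>, which for orthogonal sides is
  the product of their lengths.\<close>

lemma area_rectangle:
  assumes "rectangle P Q R S"
  shows "area P Q R S = dist P Q * dist P S"
proof -
  define p q where "p = Q - P" and "q = S - P"
  have pq: "Q = P + p" "S = P + q" "R = P + (p + q)" "p \<bullet> q = 0"
    using assms by (auto simp: rectangle_def p_def q_def algebra_simps)
  define f :: "real^2 \<Rightarrow> real^2" where "f z = z $ 1 *\<^sub>R p + z $ 2 *\<^sub>R q" for z
  have lin: "linear f"
    unfolding f_def by (intro linearI) (simp_all add: algebra_simps)
  have "convex hull {P, Q, R, S} = (+) P ` (convex hull {0, p, p + q, q})"
    unfolding pq by (simp flip: convex_hull_translation)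
  also have "{0, p, p + q, q} = f ` {0, vector [1, 0], vector [1, 1], vector [0, 1]}"
    by (simp add: f_def)
  also have "convex hull \<dots> = f ` cbox 0 1"
    by (simp only: unit_square_convex_hull convex_hull_linear_image[OF lin])
  finally have "area P Q R S = measure lebesgue (f ` cbox 0 1)"
    by (simp add: area_def measure_translation)
  also have "\<dots> = \<bar>det (matrix f)\<bar>"
    using measure_linear_image[OF lin, of "cbox 0 1"]
    by (simp add: content_cbox_cart interval_ne_empty_cart)
  also have "det (matrix f) = p $ 1 * q $ 2 - p $ 2 * q $ 1"
    by (simp add: det_2 matrix_def f_def axis_def)
  also have "\<bar>p $ 1 * q $ 2 - p $ 2 * q $ 1\<bar> = norm p * norm q"
  proof -
    \<comment> \<open>Lagrange's identity in the plane; orthogonality removes the last term.\<close>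
    have "(p $ 1 * q $ 2 - p $ 2 * q $ 1)\<^sup>2 = (p \<bullet> p) * (q \<bullet> q) - (p \<bullet> q)\<^sup>2"
      by (simp add: inner_vec_def sum_2 power2_eq_square algebra_simps)
    also have "\<dots> = (norm p * norm q)\<^sup>2"
      by (simp add: \<open>p \<bullet> q = 0\<close> power2_norm_eq_inner power_mult_distrib)
    finally show ?thesis
      by (subst power2_eq_iff_nonneg[symmetric]) simp_all
  qed
  finally show ?thesis
    by (simp add: pq dist_norm)
qed

section \<open>The two-focus equation of a hyperbola\<close>

text \<open>The usual elimination of the radicals by squaring twice, with each squaring checked to
  be reversible. The foci are \<open>(0, f)\<close> and \<open>(0, - f)\<close>, so the transverse
  axis is vertical.\<close>

lemma focal_difference_iff:
  fixes a f x y :: real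
  assumes "0 < a" "a < f"
  shows "\<bar>sqrt (x\<^sup>2 + (y - f)\<^sup>2) - sqrt (x\<^sup>2 + (y + f)\<^sup>2)\<bar> = 2 * a \<longleftrightarrow>
    (f\<^sup>2 - a\<^sup>2) * y\<^sup>2 = a\<^sup>2 * (x\<^sup>2 + f\<^sup>2 - a\<^sup>2)"
proof -
  define p q N where "p = sqrt (x\<^sup>2 + (y - f)\<^sup>2)" and "q = sqrt (x\<^sup>2 + (y + f)\<^sup>2)"
    and "N = x\<^sup>2 + y\<^sup>2 + f\<^sup>2 - 2 * a\<^sup>2"
  have nonneg: "p \<ge> 0" "q \<ge> 0"
    by (auto simp: p_def q_def)
  have sq: "p\<^sup>2 = x\<^sup>2 + (y - f)\<^sup>2" "q\<^sup>2 = x\<^sup>2 + (y + f)\<^sup>2"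
    by (auto simp: p_def q_def)
  have fa: "a\<^sup>2 < f\<^sup>2"
    using assms by (simp add: power_strict_mono)
  have "\<bar>p - q\<bar> = 2 * a \<longleftrightarrow> (p - q)\<^sup>2 = (2 * a)\<^sup>2"
    using assms by (metis abs_of_pos mult_pos_pos power2_eq_iff_nonneg abs_ge_zero power2_abs
      zero_less_numeral)
  \<comment> \<open>Since \<open>p\<^sup>2 + q\<^sup>2 = 2 * (x\<^sup>2 + y\<^sup>2 +
    f\<^sup>2)\<close>, expanding \<open>(p - q)\<^sup>2\<close> leaves the product
    \<open>p * q\<close> as the only radical term, and \<open>N\<close> is the value it must
    take.\<close>
  also have "\<dots> \<longleftrightarrow> p * q = N"
    using sq by (auto simp: N_def power2_eq_square algebra_simps)
  also have "\<dots> \<longleftrightarrow> N \<ge> 0 \<and> (p * q)\<^sup>2 = N\<^sup>2"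
    using nonneg by (metis mult_nonneg_nonneg power2_eq_iff_nonneg)
  also have "(p * q)\<^sup>2 = N\<^sup>2 \<longleftrightarrow> (f\<^sup>2 - a\<^sup>2) * y\<^sup>2 = a\<^sup>2 * (x\<^sup>2 + f\<^sup>2 - a\<^sup>2)"
  proof -
    have "N\<^sup>2 - (p * q)\<^sup>2 = 4 * ((f\<^sup>2 - a\<^sup>2) * y\<^sup>2 - a\<^sup>2 * (x\<^sup>2 + f\<^sup>2 - a\<^sup>2))"
      unfolding power_mult_distrib sq N_def by algebra
    then show ?thesis
      by (metis eq_iff_diff_eq_0 mult_eq_0_iff zero_neq_numeral)
  qed
  \<comment> \<open>The sign condition from the second squaring is automatic: the conic equation
    forces \<open>a\<^sup>2 \<le> y\<^sup>2\<close>, whence \<open>N\<close> is at least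
    \<open>x\<^sup>2 + f\<^sup>2 - a\<^sup>2\<close>, which is positive.\<close>
  also have "N \<ge> 0 \<and> (f\<^sup>2 - a\<^sup>2) * y\<^sup>2 = a\<^sup>2 * (x\<^sup>2 + f\<^sup>2 - a\<^sup>2) \<longleftrightarrow>
      (f\<^sup>2 - a\<^sup>2) * y\<^sup>2 = a\<^sup>2 * (x\<^sup>2 + f\<^sup>2 - a\<^sup>2)"
  proof -
    have "N \<ge> 0" if "(f\<^sup>2 - a\<^sup>2) * y\<^sup>2 = a\<^sup>2 * (x\<^sup>2 + f\<^sup>2 - a\<^sup>2)"
    proof -
      have "(f\<^sup>2 - a\<^sup>2) * a\<^sup>2 \<le> (f\<^sup>2 - a\<^sup>2) * y\<^sup>2"
        unfolding that by (simp add: algebra_simps)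
      then have "a\<^sup>2 \<le> y\<^sup>2"
        using fa by simp
      then show ?thesis
        using fa zero_le_power2[of x] unfolding N_def by linarith
    qed
    then show ?thesis by blast
  qed
  finally show ?thesis
    unfolding p_def q_def .
qed

section \<open>Coordinates in an orthonormal frame\<close>

text \<open>The frame adapts to the given segment, so the figure is computed in coordinates where it
  stands, without first moving it by an isometry.\<close>

locale orthonormal_frame =
  fixes A u v :: point
  assumes norm_u: "norm u = 1" and norm_v: "norm v = 1" and orth: "u \<bullet> v = 0"
begin

definition pt :: "real \<Rightarrow> real \<Rightarrow> point" where
  "pt x y = A + x *\<^sub>R u + y *\<^sub>R v"

lemma inner_frame: "u \<bullet> u = 1" "v \<bullet> v = 1" "u \<bullet> v = 0" "v \<bullet> u = 0"
  using norm_u norm_v orth by (auto simp: norm_eq_1 inner_commute)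

lemma pt_inner: "(pt x y - A) \<bullet> u = x" "(pt x y - A) \<bullet> v = y"
  by (simp_all add: pt_def inner_frame inner_add_left)

lemma pt_eq_iff: "pt x y = pt x' y' \<longleftrightarrow> x = x' \<and> y = y'"
  by (metis pt_inner)

text \<open>Two orthonormal vectors span the plane, so every point has coordinates.\<close>

lemma pt_exists: "\<exists>x y. P = pt x y"
proof -
  have eqs: "u $ 1 * u $ 1 + u $ 2 * u $ 2 = 1" "v $ 1 * v $ 1 + v $ 2 * v $ 2 = 1"
    "u $ 1 * v $ 1 + u $ 2 * v $ 2 = 0"
    using inner_frame by (simp_all add: inner_vec_def sum_2)
  \<comment> \<open>The matrix with rows \<open>u\<close> and \<open>v\<close> has orthonormal rows,
    hence also orthonormal columns; the column relations give the expansion of \<open>w\<close>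
    componentwise.\<close>
  have "u $ 1 * u $ 1 + v $ 1 * v $ 1 = 1" "u $ 2 * u $ 2 + v $ 2 * v $ 2 = 1"
    "u $ 1 * u $ 2 + v $ 1 * v $ 2 = 0"
    using eqs by algebra+
  moreover define w where "w = P - A"
  ultimately have "w = (w \<bullet> u) *\<^sub>R u + (w \<bullet> v) *\<^sub>R v"
    unfolding vec_eq_iff forall_2 inner_vec_def sum_2 
    by (simp, algebra)
  then have "P = pt (w \<bullet> u) (w \<bullet> v)"
    by (simp add: pt_def w_def algebra_simps)
  then show ?thesis by blast
qed

lemma pt_cases: obtains x y where "P = pt x y"
  using pt_exists by blast

lemma pt_diff: "pt x y - pt x' y' = (x - x') *\<^sub>R u + (y - y') *\<^sub>R v"
  by (simp add: pt_def algebra_simps)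

lemma dist_pt: "dist (pt x y) (pt x' y') = sqrt ((x - x')\<^sup>2 + (y - y')\<^sup>2)"
  by (simp add: dist_norm pt_diff norm_eq_sqrt_inner inner_add_left inner_add_right inner_frame
      power2_eq_square)

lemma pt_origin: "pt 0 0 = A"
  by (simp add: pt_def)

lemma frame_eq_iff: "x *\<^sub>R u + y *\<^sub>R v = x' *\<^sub>R u + y' *\<^sub>R v \<longleftrightarrow> x = x' \<and> y = y'"
  using pt_eq_iff[of x y x' y'] by (simp add: pt_def)

lemma rectangle_pt_iff:
  "rectangle (pt x0 y0) (pt x1 y1) (pt x2 y2) (pt x3 y3) \<longleftrightarrow>
    (x1, y1) \<noteq> (x0, y0) \<and> (x3, y3) \<noteq> (x0, y0) \<and>
    (x1 - x0) * (x3 - x0) + (y1 - y0) * (y3 - y0) = 0 \<and>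
    x2 - x1 = x3 - x0 \<and> y2 - y1 = y3 - y0"
  by (simp add: rectangle_def pt_eq_iff pt_diff frame_eq_iff inner_add_left inner_add_right
      inner_frame mult.commute)

lemma affine_pt: "(1 - t) *\<^sub>R pt x y + t *\<^sub>R pt x' y' = pt ((1 - t) * x + t * x') ((1 - t) * y + t * y')"
  by (simp add: pt_def algebra_simps)

text \<open>The corner \<open>A\<close> occurs in the figure under its own name; these instances let
  the coordinate rules apply to it.\<close>

lemmas dist_origin = dist_pt[of 0 0, unfolded pt_origin]
  and rectangle_origin_iff = rectangle_pt_iff[of 0 0, unfolded pt_origin]
  and origin_eq_iff = pt_eq_iff[of 0 0, unfolded pt_origin]
  and affine_origin = affine_pt[of _ 0 0, unfolded pt_origin]

lemma affine_hull_pt_iff: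
  "P \<in> affine hull {pt x y, pt x' y'} \<longleftrightarrow>
    (\<exists>t. P = pt ((1 - t) * x + t * x') ((1 - t) * y + t * y'))"
proof -
  have "P \<in> affine hull {pt x y, pt x' y'} \<longleftrightarrow> (\<exists>t. P = (1 - t) *\<^sub>R pt x y + t *\<^sub>R pt x' y')"
    unfolding affine_hull_2 by (auto simp: eq_diff_eq[symmetric])
  then show ?thesis
    by (simp add: affine_pt)
qed

lemma closed_segment_pt_iff:
  "P \<in> closed_segment (pt x y) (pt x' y') \<longleftrightarrow>
    (\<exists>t. 0 \<le> t \<and> t \<le> 1 \<and> P = pt ((1 - t) * x + t * x') ((1 - t) * y + t * y'))"
  unfolding closed_segment_def affine_pt by auto

lemma ray_pt_iff: "P \<in> ray A (pt x y) \<longleftrightarrow> (\<exists>t\<ge>0. P = pt (t * x) (t * y))"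
  by (auto simp: ray_def pt_def algebra_simps)

section \<open>The conic that carries the locus\<close>

lemma hyperbola_through_origin:
  assumes "c > 0" "l > 0"
  shows "hyperbola {pt x y |x y. x\<^sup>2 = (c + l * y) * y}"
proof -
  txt \<open>Completing the square gives \<open>l * (y + a)\<^sup>2 - x\<^sup>2 = l * a\<^sup>2\<close>: centre \<open>(0, - a)\<close>, semi-axes
    \<open>a\<close> and \<open>sqrt l * a\<close>, and foci at distance \<open>f\<close> from the centre.\<close>
  define a f where "a = c / (2 * l)" and "f = sqrt (a\<^sup>2 + c\<^sup>2 / (4 * l))"
  have "a > 0"
    using assms by (simp add: a_def)
  have f2: "f\<^sup>2 = a\<^sup>2 + c\<^sup>2 / (4 * l)"
    using assms by (simp add: f_def)
  have "a < f"
    using assms unfolding f_def by (intro real_less_rsqrt) simp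
  have c: "c = 2 * l * a" using assms by (simp add: a_def)
  have iff: "\<bar>dist (pt x y) (pt 0 (f - a)) - dist (pt x y) (pt 0 (- f - a))\<bar> = 2 * a \<longleftrightarrow>
      x\<^sup>2 = (c + l * y) * y" for x y
  proof -
    \<comment> \<open>With \<open>c = 2 * l * a\<close> the term \<open>c\<^sup>2 / (4 * l)\<close>
      equals \<open>l * a\<^sup>2\<close>, the square of the second semi-axis.\<close>
    have fa: "f\<^sup>2 - a\<^sup>2 = l * a\<^sup>2"
      unfolding f2 using assms by (simp add: c power2_eq_square)
    have "\<bar>dist (pt x y) (pt 0 (f - a)) - dist (pt x y) (pt 0 (- f - a))\<bar> = 2 * a \<longleftrightarrow>
        (f\<^sup>2 - a\<^sup>2) * (y + a)\<^sup>2 = a\<^sup>2 * (x\<^sup>2 + f\<^sup>2 - a\<^sup>2)"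
      using focal_difference_iff[OF \<open>a > 0\<close> \<open>a < f\<close>, of x "y + a"]
      by (simp add: dist_pt algebra_simps)
    also have "\<dots> \<longleftrightarrow> a\<^sup>2 * (l * (y + a)\<^sup>2) = a\<^sup>2 * (x\<^sup>2 + l * a\<^sup>2)"
      using fa by (simp add: add_diff_eq[symmetric] mult.assoc mult.left_commute)
    \<comment> \<open>After cancelling \<open>a\<^sup>2\<close>, the constant
      \<open>l * a\<^sup>2\<close> drops out on both sides and \<open>2 * l * a * y\<close> is
      \<open>c * y\<close>.\<close>
    also have "\<dots> \<longleftrightarrow> x\<^sup>2 = (c + l * y) * y"
      using \<open>a > 0\<close> by (simp add: c) (simp add: power2_eq_square algebra_simps eq_commute)
    finally show ?thesis .
  qed
  have "{pt x y |x y. x\<^sup>2 = (c + l * y) * y} =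
      {P. \<bar>dist P (pt 0 (f - a)) - dist P (pt 0 (- f - a))\<bar> = 2 * a}"
  proof (intro set_eqI)
    fix P
    obtain x y where "P = pt x y" by (rule pt_cases)
    then show "P \<in> {pt x y |x y. x\<^sup>2 = (c + l * y) * y} \<longleftrightarrow>
        P \<in> {P. \<bar>dist P (pt 0 (f - a)) - dist P (pt 0 (- f - a))\<bar> = 2 * a}"
      by (auto simp: iff pt_eq_iff)
  qed
  moreover have "2 * a < dist (pt 0 (f - a)) (pt 0 (- f - a))"
    using \<open>a < f\<close> \<open>a > 0\<close> by (simp add: dist_pt real_sqrt_mult)
  ultimately show ?thesis
    unfolding hyperbola_def using \<open>a > 0\<close> by blast
qed

section \<open>The applied rectangle, the square and their intersection in coordinates\<close>

text \<open>The vertex order in \<open>similar\<close> pairs \<open>B B'\<close> with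
  \<open>Y1 Y2\<close> and \<open>B C\<close> with \<open>Y1 Y4\<close>, so the excess is
  \<open>l\<close> times the height. The height \<open>d\<close> is then the only remaining
  freedom.\<close>

lemma applied_exceeding_iff:
  assumes Y: "rectangle Y1 Y2 Y3 Y4" and "c > 0" "e > 0"
  defines "l \<equiv> dist Y1 Y2 / dist Y1 Y4"
  shows "applied_exceeding Y1 Y2 Y3 Y4 A (pt c 0) (pt 0 e) B' C' D \<longleftrightarrow>
    (\<exists>d>0. B' = pt (c + l * d) 0 \<and> C' = pt (c + l * d) d \<and> D = pt 0 d)"
    (is "?L \<longleftrightarrow> ?R")
proof
  have pos: "dist Y1 Y2 > 0" "dist Y1 Y4 > 0"
    using Y by (auto simp: rectangle_def)
  {
    assume ?L
    then obtain C where rect: "rectangle A B' C' D" and B: "pt c 0 \<in> open_segment A B'"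
      and D: "D \<in> ray A (pt 0 e)" and rect': "rectangle (pt c 0) B' C' C"
      and sim: "similar [pt c 0, B', C', C] [Y1, Y2, Y3, Y4]"
      by (auto simp: applied_exceeding_def)
    obtain b1 b2 where B': "B' = pt b1 b2" by (rule pt_cases)
    obtain c1 c2 where C': "C' = pt c1 c2" by (rule pt_cases)
    obtain g1 g2 where C: "C = pt g1 g2" by (rule pt_cases)
    from D obtain t where t: "t \<ge> 0" "D = pt 0 (t * e)"
      by (auto simp: ray_pt_iff)
    define d where "d = t * e"
    have D: "D = pt 0 d" "d \<ge> 0"
      using t \<open>e > 0\<close> by (auto simp: d_def)
    have r: "d \<noteq> 0" "b2 = 0" "c1 = b1" "c2 = d"
      using rect unfolding B' C' D(1) rectangle_origin_iff by auto
    have r': "b1 \<noteq> c" "g1 = c" "g2 = d"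
      using rect' unfolding B' C' C rectangle_pt_iff by (auto simp: r)
    \<comment> \<open>The distance from \<open>B\<close> to \<open>B'\<close> yields the excess only
      up to sign. Betweenness settles it: \<open>c = s * b1\<close> with \<open>0 < s < 1\<close>
      places \<open>B'\<close> beyond \<open>B\<close>.\<close>
    obtain s where s: "0 < s" "s < 1" "pt c 0 = (1 - s) *\<^sub>R A + s *\<^sub>R B'"
      using B by (auto simp: in_segment)
    then have "c = s * b1"
      unfolding B' affine_origin by (simp add: pt_eq_iff)
    moreover have "b1 > 0"
      using \<open>c = s * b1\<close> s \<open>c > 0\<close> by (simp add: zero_less_mult_iff)
    ultimately have "c < b1"
      using s by simp
    obtain k where "dist (pt c 0) B' = k * dist Y1 Y2" "dist (pt c 0) C = k * dist Y1 Y4"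
      using sim similar_rectangles_iff[OF rect' Y] by blast
    then have "b1 - c = k * dist Y1 Y2" "d = k * dist Y1 Y4"
      using \<open>c < b1\<close> \<open>d \<ge> 0\<close> by (simp_all add: B' C r r' dist_pt)
    then have "b1 = c + l * d"
      using pos by (simp add: l_def algebra_simps)
    then show ?R
      using D r by (intro exI[of _ d]) (simp add: B' C')
  next
    assume ?R
    then obtain d where "d > 0" and d: "B' = pt (c + l * d) 0" "C' = pt (c + l * d) d" "D = pt 0 d"
      by blast
    have "l > 0"
      using pos by (simp add: l_def)
    then have ld: "l * d > 0" using \<open>d > 0\<close> by simp
    have rect': "rectangle (pt c 0) B' C' (pt c d)"
      using ld \<open>d > 0\<close> unfolding d rectangle_pt_iff by auto
    \<comment> \<open>The scale factor is read off from the heights, \<open>d\<close> against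
      \<open>dist Y1 Y4\<close>; the bases then agree by the definition of \<open>l\<close>.\<close>
    moreover have "similar [pt c 0, B', C', pt c d] [Y1, Y2, Y3, Y4]"
      unfolding similar_rectangles_iff[OF rect' Y]
      using \<open>d > 0\<close> pos ld by (intro exI[of _ "d / dist Y1 Y4"]) (simp add: d dist_pt l_def)
    moreover have "rectangle A B' C' D"
      using ld \<open>d > 0\<close> \<open>c > 0\<close> unfolding d rectangle_origin_iff by auto
    moreover have "pt c 0 \<in> open_segment A B'"
      using ld \<open>c > 0\<close> unfolding d in_segment affine_origin
      by (auto simp: pt_eq_iff origin_eq_iff intro!: exI[of _ "c / (c + l * d)"])
    moreover have "D \<in> ray A (pt 0 e)"
      unfolding ray_pt_iff d using \<open>d > 0\<close> \<open>e > 0\<close> by (intro exI[of _ "d / e"]) simp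
    ultimately show ?L
      unfolding applied_exceeding_def by blast
  }
qed

text \<open>The two rays confine \<open>I\<close> and \<open>G\<close> to the nonnegative half-axes,
  so the side is the nonnegative root of \<open>s * s = b * d\<close>.\<close>

lemma companion_square_iff:
  assumes "c > 0" "d > 0" "b > 0"
  shows "companion_square A (pt c 0) (pt b 0) (pt b d) (pt 0 d) I H G \<longleftrightarrow>
    I = pt (sqrt (b * d)) 0 \<and> H = pt (sqrt (b * d)) (sqrt (b * d)) \<and> G = pt 0 (sqrt (b * d))"
    (is "?L \<longleftrightarrow> ?R")
proof
  have "rectangle A (pt b 0) (pt b d) (pt 0 d)"
    using assms unfolding rectangle_origin_iff by auto
  from area_rectangle[OF this] have area: "area A (pt b 0) (pt b d) (pt 0 d) = b * d"
    using assms by (simp add: dist_origin dist_pt)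
  {
    assume ?L
    then have rect: "rectangle A I H G" and eq: "dist A I = dist A G" and I: "I \<in> ray A (pt c 0)"
      and G: "G \<in> ray A (pt 0 d)" and ar: "area A I H G = b * d"
      by (auto simp: companion_square_def square_def area)
    from I obtain t1 where "t1 \<ge> 0" and t1: "I = pt (t1 * c) 0"
      by (auto simp: ray_pt_iff)
    from G obtain t2 where "t2 \<ge> 0" and t2: "G = pt 0 (t2 * d)"
      by (auto simp: ray_pt_iff)
    define s t where "s = t1 * c" and "t = t2 * d"
    have s: "s \<ge> 0" "I = pt s 0" and t: "t \<ge> 0" "G = pt 0 t"
      using \<open>t1 \<ge> 0\<close> \<open>t2 \<ge> 0\<close> t1 t2 assms by (simp_all add: s_def t_def)
    obtain h1 h2 where H: "H = pt h1 h2" by (rule pt_cases)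
    have "h1 = s" "h2 = t"
      using rect unfolding s(2) t(2) H rectangle_origin_iff by auto
    moreover have st: "s = t"
      using eq s(1) t(1) unfolding s(2) t(2) by (simp add: dist_origin)
    moreover have "s * t = b * d"
      using area_rectangle[OF rect] s(1) t(1) ar unfolding s(2) t(2)
      by (simp add: dist_origin)
    moreover from this have "s = sqrt (b * d)"
      using s(1) by (simp add: st flip: \<open>s * t = b * d\<close>)
    ultimately show ?R
      using s t H by auto
  next
    assume ?R
    moreover define s where "s = sqrt (b * d)"
    ultimately have eqs: "I = pt s 0" "H = pt s s" "G = pt 0 s"
      by auto
    have "s > 0" "s * s = b * d"
      using assms by (simp_all add: s_def)
    have rect: "rectangle A I H G"
      using \<open>s > 0\<close> unfolding eqs rectangle_origin_iff by auto
    moreover have "dist A I = s" "dist A G = s"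
      using \<open>s > 0\<close> unfolding eqs by (auto simp: dist_origin)
    moreover have "I \<in> ray A (pt c 0)" "G \<in> ray A (pt 0 d)"
      unfolding ray_pt_iff eqs using assms \<open>s > 0\<close>
      by (auto intro: exI[of _ "s / c"] exI[of _ "s / d"])
    ultimately show ?L
      unfolding companion_square_def square_def
      using area_rectangle[OF rect] area \<open>s * s = b * d\<close> by simp
  }
qed

text \<open>The extended sides are the perpendicular lines \<open>x = s\<close> and
  \<open>y = d\<close>, which always meet in exactly one point. Only for a rectangle at least as
  wide as high must that point also be located on the sides themselves.\<close>

lemma sides_intersection:
  assumes "b > 0" "d > 0"
  defines "s \<equiv> sqrt (b * d)"
  shows "J \<in> (if b < d then affine hull {pt s 0, pt s s} \<inter> affine hull {pt 0 d, pt b d}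
      else closed_segment (pt s 0) (pt s s) \<inter> closed_segment (pt 0 d) (pt b d)) \<longleftrightarrow> J = pt s d"
proof -
  have "s > 0"
    using assms by simp
  have lines: "J \<in> affine hull {pt s 0, pt s s} \<inter> affine hull {pt 0 d, pt b d} \<longleftrightarrow> J = pt s d"
  proof
    assume "J \<in> affine hull {pt s 0, pt s s} \<inter> affine hull {pt 0 d, pt b d}"
    then show "J = pt s d"
      by (auto simp: affine_hull_pt_iff pt_eq_iff algebra_simps)
  next
    assume J: "J = pt s d"
    have "J \<in> affine hull {pt s 0, pt s s}"
      unfolding affine_hull_pt_iff J using \<open>s > 0\<close>
      by (intro exI[of _ "d / s"]) (simp add: pt_eq_iff algebra_simps)
    moreover have "J \<in> affine hull {pt 0 d, pt b d}"
      unfolding affine_hull_pt_iff J using \<open>b > 0\<close>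
      by (intro exI[of _ "s / b"]) (simp add: pt_eq_iff algebra_simps)
    ultimately show "J \<in> affine hull {pt s 0, pt s s} \<inter> affine hull {pt 0 d, pt b d}"
      by blast
  qed
  show ?thesis
  proof (cases "b < d")
    case True
    then show ?thesis
      using lines by simp
  next
    case False
    \<comment> \<open>The side \<open>s\<close> is the geometric mean of \<open>d\<close> and
      \<open>b\<close>, so it lies between them; this puts the meeting point on both
      segments.\<close>
    have "d \<le> s" "s \<le> b"
      using False assms by (auto simp: s_def power2_eq_square intro!: real_le_rsqrt real_le_lsqrt)
    have "pt s d \<in> closed_segment (pt s 0) (pt s s)"
      unfolding closed_segment_pt_iff using \<open>s > 0\<close> \<open>d \<le> s\<close> \<open>d > 0\<close>
      by (intro exI[of _ "d / s"]) (simp add: pt_eq_iff algebra_simps)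
    moreover have "pt s d \<in> closed_segment (pt 0 d) (pt b d)"
      unfolding closed_segment_pt_iff using \<open>s > 0\<close> \<open>s \<le> b\<close> \<open>b > 0\<close>
      by (intro exI[of _ "s / b"]) (simp add: pt_eq_iff algebra_simps)
    \<comment> \<open>Uniqueness on the segments is inherited from the lines containing
      them.\<close>
    moreover have "closed_segment P Q \<subseteq> affine hull {P, Q}" for P Q :: point
      by (metis convex_hull_subset_affine_hull segment_convex_hull)
    ultimately show ?thesis
      using lines False by auto
  qed
qed

text \<open>The height fixes the rectangle, the rectangle fixes the square, and together they fix
  the intersection; the side of the square is \<open>sqrt \<alpha>\<close> because its area is
  \<open>\<alpha>\<close>.\<close>

lemma J_plus_iff:
  assumes Y: "rectangle Y1 Y2 Y3 Y4" and "c > 0" "e > 0"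
  defines "l \<equiv> dist Y1 Y2 / dist Y1 Y4"
  shows "J_plus Y1 Y2 Y3 Y4 A (pt c 0) (pt 0 e) \<alpha> J \<longleftrightarrow>
    (\<exists>d>0. (c + l * d) * d = \<alpha> \<and> J = pt (sqrt \<alpha>) d)"
proof -
  have "l \<ge> 0"
    by (simp add: l_def)
  have area: "area A (pt (c + l * d) 0) (pt (c + l * d) d) (pt 0 d) = (c + l * d) * d"
    and pos: "c + l * d > 0"
    and dists: "dist A (pt (c + l * d) 0) = c + l * d" "dist (pt (c + l * d) 0) (pt (c + l * d) d) = d"
    if "d > 0" for d
  proof -
    show pos: "c + l * d > 0"
      using that \<open>l \<ge> 0\<close> \<open>c > 0\<close> by (simp add: add_pos_nonneg)
    have "rectangle A (pt (c + l * d) 0) (pt (c + l * d) d) (pt 0 d)"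
      using that pos unfolding rectangle_origin_iff by auto
    from area_rectangle[OF this]
    show "area A (pt (c + l * d) 0) (pt (c + l * d) d) (pt 0 d) = (c + l * d) * d"
      using that pos by (simp add: dist_origin dist_pt)
    show "dist A (pt (c + l * d) 0) = c + l * d" "dist (pt (c + l * d) 0) (pt (c + l * d) d) = d"
      using that pos by (simp_all add: dist_origin dist_pt)
  qed
  have "J_plus Y1 Y2 Y3 Y4 A (pt c 0) (pt 0 e) \<alpha> J \<longleftrightarrow>
      (\<exists>d>0. (c + l * d) * d = \<alpha> \<and> (\<exists>I H G.
        companion_square A (pt c 0) (pt (c + l * d) 0) (pt (c + l * d) d) (pt 0 d) I H G \<and>
        J \<in> (if c + l * d < d
             then affine hull {I, H} \<inter> affine hull {pt 0 d, pt (c + l * d) d}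
             else closed_segment I H \<inter> closed_segment (pt 0 d) (pt (c + l * d) d))))"
    (is "_ \<longleftrightarrow> (\<exists>d>0. _ \<and> ?Q d)")
    unfolding J_plus_def applied_exceeding_iff[OF assms(1-3), folded l_def]
    using area dists by fastforce
  also have "\<dots> \<longleftrightarrow> (\<exists>d>0. (c + l * d) * d = \<alpha> \<and> J = pt (sqrt \<alpha>) d)"
  proof (intro ex_cong1 conj_cong refl)
    fix d assume "d > 0" and \<alpha>: "(c + l * d) * d = \<alpha>"
    show "?Q d \<longleftrightarrow> J = pt (sqrt \<alpha>) d"
      unfolding companion_square_iff[OF \<open>c > 0\<close> \<open>d > 0\<close> pos[OF \<open>d > 0\<close>]]
      using sides_intersection[OF pos[OF \<open>d > 0\<close>] \<open>d > 0\<close>, of J, unfolded \<alpha>]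
      by (simp add: \<alpha>)
  qed
  finally show ?thesis .
qed

end

section \<open>The height belonging to an area, and the locus\<close>

lemma applied_height_unique:
  fixes c l \<alpha> :: real
  assumes "c > 0" "l > 0" "\<alpha> > 0"
  shows "\<exists>!d. d > 0 \<and> (c + l * d) * d = \<alpha>"
proof (rule ex_ex1I)
  \<comment> \<open>\<open>r\<close> is the root of the discriminant of
    \<open>l * d\<^sup>2 + c * d - \<alpha>\<close>, and \<open>(r - c) / (2 * l)\<close> is the
    positive solution.\<close>
  define r where "r = sqrt (c\<^sup>2 + 4 * l * \<alpha>)"
  have r2: "r * r = c\<^sup>2 + 4 * l * \<alpha>"
    using assms by (simp add: r_def)
  have "r > c"
    using assms unfolding r_def by (intro real_less_rsqrt) simp
  have "(c + l * ((r - c) / (2 * l))) * ((r - c) / (2 * l)) = (r * r - c\<^sup>2) / (4 * l)"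
    using assms by (simp add: field_simps power2_eq_square)
  also have "\<dots> = \<alpha>"
    using assms by (simp add: r2)
  finally show "\<exists>d. d > 0 \<and> (c + l * d) * d = \<alpha>"
    using \<open>r > c\<close> \<open>l > 0\<close> by (intro exI[of _ "(r - c) / (2 * l)"]) simp
next
  fix d d' assume d: "d > 0 \<and> (c + l * d) * d = \<alpha>" "d' > 0 \<and> (c + l * d') * d' = \<alpha>"
  \<comment> \<open>Subtracting the two equations produces the factor \<open>d - d'\<close>; the
    cofactor is positive.\<close>
  then have "(c + l * (d + d')) * (d - d') = 0"
    by (simp add: algebra_simps)
  moreover have "c + l * (d + d') > 0"
    using assms d by (intro add_pos_pos mult_pos_pos) auto
  ultimately show "d = d'" by simp
qed

text \<open>The quadrant cuts out the traced arc: \<open>hyperbola\<close> takes both branches, and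
  of these one lies below the line \<open>A B\<close> while the other passes through
  \<open>A\<close> and continues symmetrically across the line \<open>A E\<close>.\<close>

theorem corollary3:
  fixes A B E Y1 Y2 Y3 Y4 :: point
  assumes "A \<noteq> B"
    and "E \<noteq> A" and "(E - A) \<bullet> (B - A) = 0"
    and "rectangle Y1 Y2 Y3 Y4"
  shows "(\<forall>\<alpha>>0. \<exists>!J. J_plus Y1 Y2 Y3 Y4 A B E \<alpha> J) \<and>
    (\<exists>K. hyperbola K \<and>
       {J. \<exists>\<alpha>>0. J_plus Y1 Y2 Y3 Y4 A B E \<alpha> J} =
         K \<inter> {P. 0 < (P - A) \<bullet> (B - A) \<and> 0 < (P - A) \<bullet> (E - A)})"
proof -
  define c e l where "c = norm (B - A)" and "e = norm (E - A)"
    and "l = dist Y1 Y2 / dist Y1 Y4"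
  define u v where "u = (B - A) /\<^sub>R c" and "v = (E - A) /\<^sub>R e"
  have pos: "c > 0" "e > 0" "l > 0"
    using assms by (auto simp: c_def e_def l_def rectangle_def)
  interpret orthonormal_frame A u v
  proof
    show "norm u = 1" "norm v = 1"
      using pos by (simp_all add: u_def v_def c_def e_def)
    show "u \<bullet> v = 0"
      using assms(3) by (simp add: u_def v_def inner_commute)
  qed
  have BE: "B = pt c 0" "E = pt 0 e"
    unfolding pt_def using pos by (simp_all add: u_def v_def)
  have J: "J_plus Y1 Y2 Y3 Y4 A B E \<alpha> J \<longleftrightarrow> (\<exists>d>0. (c + l * d) * d = \<alpha> \<and> J = pt (sqrt \<alpha>) d)"
    for \<alpha> J
    unfolding BE l_def using J_plus_iff[OF assms(4) pos(1,2)] .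
  have "\<exists>!J. J_plus Y1 Y2 Y3 Y4 A B E \<alpha> J" if "\<alpha> > 0" for \<alpha>
    unfolding J using applied_height_unique[OF pos(1,3) that] by metis
  moreover have "{J. \<exists>\<alpha>>0. J_plus Y1 Y2 Y3 Y4 A B E \<alpha> J} =
      {pt x y |x y. x\<^sup>2 = (c + l * y) * y} \<inter> {P. 0 < (P - A) \<bullet> (B - A) \<and> 0 < (P - A) \<bullet> (E - A)}"
  proof (intro set_eqI)
    fix P
    obtain x y where P: "P = pt x y" by (rule pt_cases)
    have "B - A = c *\<^sub>R u" "E - A = e *\<^sub>R v"
      using pos by (simp_all add: u_def v_def)
    then have quadrant: "0 < (P - A) \<bullet> (B - A) \<longleftrightarrow> x > 0" "0 < (P - A) \<bullet> (E - A) \<longleftrightarrow> y > 0"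
      using pos by (simp_all add: P pt_inner zero_less_mult_iff)
    have "(\<exists>\<alpha>>0. J_plus Y1 Y2 Y3 Y4 A B E \<alpha> P) \<longleftrightarrow>
        y > 0 \<and> (c + l * y) * y > 0 \<and> x = sqrt ((c + l * y) * y)"
      unfolding J P by (auto simp: pt_eq_iff)
    \<comment> \<open>For \<open>x > 0\<close> the square root is undone by squaring, and the area
      belonging to the point is \<open>x\<^sup>2\<close>, hence positive.\<close>
    also have "\<dots> \<longleftrightarrow> x\<^sup>2 = (c + l * y) * y \<and> x > 0 \<and> y > 0"
      by (smt (verit) real_sqrt_gt_zero real_sqrt_pow2 real_sqrt_unique zero_less_power)
    finally show "P \<in> {J. \<exists>\<alpha>>0. J_plus Y1 Y2 Y3 Y4 A B E \<alpha> J} \<longleftrightarrow>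
        P \<in> {pt x y |x y. x\<^sup>2 = (c + l * y) * y} \<inter>
          {P. 0 < (P - A) \<bullet> (B - A) \<and> 0 < (P - A) \<bullet> (E - A)}"
      using quadrant by (auto simp: P pt_eq_iff)
  qed
  ultimately show ?thesis
    using hyperbola_through_origin[OF pos(1,3)] by blast
qed

end
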